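(* Let $P$ be an unbounded polyhedron containing no affine line, and let $\overline{P}$ be a projectively equivalent polytope with marked face $\overline{F}$. Given the vertex-facet incidences of $\overline{P}$, the algorithm FaceIterator visits exactly once all non-empty faces of $P$. That is, identifying faces of $\overline{P}$ with their vertex sets, when FaceIterator is called with $C$ the list of facets of $\overline{P}$ not contained in $\overline{F}$, $I$ the list with single entry $\overline{F}$, and $J=\emptyset$, it outputs exactly once each face of $\overline{P}$ corresponding to a non-empty face of $P$ other than $P$ itself, and nothing else; the face $P$ is, by convention, visited additionally as the upper bound.
   Context: A polytope $\overline{P}$ with marked face $\overline{F}$ projectively equivalent to $P$ is a polytope obtained as the closure of the image of $P$ under an admissible projective transformation, where $\overline{F}$ is the face of $\overline{P}$ consisting of the points added at infinity. The non-empty faces of $P$ correspond bijectively (by taking closures of images, and preserving inclusion) to the faces of $\overline{P}$ not contained in $\overline{F}$. Algorithm FaceIterator$(C,I,J)$, where $\{1,\dots,n\}$ labels the vertices of $\overline{P}$, $C$ is a list (without repetitions) of subsets of $\{1,\dots,n\}$, $I$ is a list of subsets of $\{1,\dots,n\}$ (ignored sets), and $J\subseteq\{1,\dots,n\}$ (ignored atoms). If $C$ is empty, stop. Otherwise: 1. Let $a$ be the first element of $C$. 2. If $a\cap J=\emptyset$, output $a$. 3. Let $N_1=\{a\cap b : b\in C,\ b\neq a\}$, let $N_2=\{x\in N_1 : x\not\subseteq y \text{ for all } y\in I\}$, and let $N$ be the list (without repetitions) of inclusion-maximal elements of $N_2$. 4. Call FaceIterator$(N, I, J)$ with a copy of $I$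 (so that later changes made to $I$ inside this call do not affect the current $I$). 5. Let $C'=\{x\in C : x\not\subseteq a\cup J\}$ and append $a\cup J$ to $I$. 6. Call FaceIterator$(C', I, J)$. *)

theory Defs
  imports "HOL-Analysis.Analysis"
begin

subsection \<open>The algorithm\<close>

definition lists_set :: "'b list \<Rightarrow> 'b set \<Rightarrow> bool" where
  "lists_set xs A \<longleftrightarrow> distinct xs \<and> set xs = A"

definition inclusion_maximal :: "'b set set \<Rightarrow> 'b set set" where
  "inclusion_maximal A = {x \<in> A. \<not> (\<exists>y\<in>A. x \<subset> y)}"

definition next_faces :: "nat set list \<Rightarrow> nat set list \<Rightarrow> nat set \<Rightarrow> nat set set" where
  "next_faces C I a =
     (let N1 = {a \<inter> b | b. b \<in> set C \<and> b \<noteq> a};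
          N2 = {x \<in> N1. \<forall>y\<in>set I. \<not> x \<subseteq> y}
      in inclusion_maximal N2)"

lemma next_faces_length:
  assumes "lists_set N (next_faces (a # C) I a)"
  shows "length N < Suc (length C)"
proof -
  have "set N \<subseteq> (\<lambda>b. a \<inter> b) ` set C"
    using assms by (auto simp: lists_set_def next_faces_def inclusion_maximal_def Let_def)
  then have "card (set N) \<le> card (set C)"
    by (meson List.finite_set card_image_le card_mono finite_imageI order_trans)
  then show ?thesis
    using assms card_length[of C] distinct_card by (fastforce simp only: lists_set_def)
qed

lemma remaining_length:
  assumes "lists_set C' {x \<in> set (a # C). \<not> x \<subseteq> a \<union> J}"
  shows "length C' < Suc (length C)"
proof -
  have "set C' \<subseteq> set C"
    using assms by (auto simp: lists_set_def)
  then have "card (set C') \<le> card (set C)"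
    by (simp add: card_mono)
  then show ?thesis
    using assms card_length[of C] distinct_card by (fastforce simp only: lists_set_def)
qed

text \<open>
  The order in which the new lists are arranged is not prescribed by the algorithm, so
  \<open>face_iterator C I J\<close> is the set of all possible output sequences of a call, one
  for each way of arranging these lists. Termination holds for every such choice, because both
  recursive calls receive a list shorter than \<open>C\<close>.
\<close>

function (sequential) face_iterator ::
    "nat set list \<Rightarrow> nat set list \<Rightarrow> nat set \<Rightarrow> nat set list set" where
  "face_iterator [] I J = {[]}"
| "face_iterator (a # C) I J =
     (\<Union>N \<in> {N. lists_set N (next_faces (a # C) I a)}.
      \<Union>C' \<in> {C'. lists_set C' {x \<in> set (a # C). \<not> x \<subseteq> a \<union> J}}.
        {(if a \<inter> J = {} then [a] else []) @ out1 @ out2 | out1 out2.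
           out1 \<in> face_iterator N I J \<and> out2 \<in> face_iterator C' (I @ [a \<union> J]) J})"
  by pat_completeness auto
termination
  by (relation "Wellfounded.measure (\<lambda>(C, I, J). length C)")
     (use next_faces_length remaining_length in \<open>simp_all (no_asm_use) del: list.set\<close>, blast+)


subsection \<open>Projective transformations\<close>

text \<open>
  A projective transformation \<open>x \<mapsto> (A x + b) / (c \<bullet> x + d)\<close> is given by the
  invertible linear map \<open>L (x, t) = (A x + t b, c \<bullet> x + t d)\<close> on homogeneous coordinates.
  It is admissible for \<open>P\<close> if no point of \<open>P\<close> is sent to infinity.
\<close>

definition projective_map ::
    "('a::euclidean_space \<times> real \<Rightarrow> 'a \<times> real) \<Rightarrow> 'a \<Rightarrow> 'a" where
  "projective_map L x = fst (L (x, 1)) /\<^sub>R snd (L (x, 1))"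

definition admissible_projective ::
    "('a::euclidean_space \<times> real \<Rightarrow> 'a \<times> real) \<Rightarrow> 'a set \<Rightarrow> bool" where
  "admissible_projective L P \<longleftrightarrow> linear L \<and> bij L \<and> (\<forall>x\<in>P. snd (L (x, 1)) \<noteq> 0)"

text \<open>The closure of the image of a set, and the points added to it at infinity.\<close>

definition projective_closure ::
    "('a::euclidean_space \<times> real \<Rightarrow> 'a \<times> real) \<Rightarrow> 'a set \<Rightarrow> 'a set" where
  "projective_closure L P = closure (projective_map L ` P)"

definition points_at_infinity ::
    "('a::euclidean_space \<times> real \<Rightarrow> 'a \<times> real) \<Rightarrow> 'a set \<Rightarrow> 'a set" where
  "points_at_infinity L P = projective_closure L P - projective_map L ` P"


subsection \<open>Labelled vertex sets\<close>

definition vertices :: "'a::euclidean_space set \<Rightarrow> 'a set" where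
  "vertices Q = {v. v extreme_point_of Q}"

definition vertex_labels :: "(nat \<Rightarrow> 'a) \<Rightarrow> nat \<Rightarrow> 'a set \<Rightarrow> nat set" where
  "vertex_labels v n H = {i \<in> {1..n}. v i \<in> H}"

end

theory Submission
  imports Defs
begin

text \<open>
  Only two properties of the vertex sets of faces matter to the algorithm: they are closed under
  intersection, and every non-empty face of \<open>F\<close> is the intersection of the facets of \<open>F\<close>
  containing it. By induction, if \<open>C\<close> lists the facets of a face \<open>F\<close> that lie in no ignored
  set, then a call visits once each proper face of \<open>F\<close> lying in no ignored set. Indeed the list
  \<open>N\<close> consists of the facets of \<open>a\<close> that are not ignored, because a facet of \<open>a\<close> is
  contained in a facet \<open>b\<close> of \<open>F\<close> that does not contain \<open>a\<close>, hence equals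
  \<open>a \<inter> b\<close>.

  Faces of a polyhedron are exposed, and a projective transformation turns an affine inequality on
  \<open>P\<close> into one on \<open>Pbar\<close>. The denominator of the inverse transformation is an affine
  function that is non-negative on \<open>Pbar\<close> and vanishes exactly on \<open>Fbar\<close>, so every face of
  \<open>Pbar\<close> not contained in \<open>Fbar\<close> is the closure of its part outside \<open>Fbar\<close>.
\<close>

subsection \<open>The algorithm on an intersection-closed family\<close>

text \<open>Every finite set can be arranged in a list, so each call admits some choice of
  \<open>N\<close> and \<open>C'\<close>. This keeps a claim about all output sequences from being
  vacuous.\<close>

lemma face_iterator_nonempty: "face_iterator C I J \<noteq> {}"
proof (induction C I J rule: face_iterator.induct)
  case (1 I J)
  then show ?case by simp
next
  case (2 a C I J)
  have "next_faces (a # C) I a \<subseteq> (\<lambda>b. a \<inter> b) ` set (a # C)"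
    by (auto simp: next_faces_def inclusion_maximal_def Let_def)
  then have "finite (next_faces (a # C) I a)"
    by (rule finite_subset) simp
  then obtain N where N: "lists_set N (next_faces (a # C) I a)"
    unfolding lists_set_def by (metis finite_distinct_list)
  have "finite {x \<in> set (a # C). \<not> x \<subseteq> a \<union> J}"
    by simp
  then obtain C' where C': "lists_set C' {x \<in> set (a # C). \<not> x \<subseteq> a \<union> J}"
    unfolding lists_set_def by (metis finite_distinct_list)
  obtain out1 where out1: "out1 \<in> face_iterator N I J"
    using "2.IH"(1) N C' by blast
  obtain out2 where out2: "out2 \<in> face_iterator C' (I @ [a \<union> J]) J"
    using "2.IH"(2) N C' by blast
  show ?case
    unfolding face_iterator.simps using N C' out1 out2 by blast
qed

text \<open>When \<open>A\<close> consists of the vertex sets of the faces of a polytope, these are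
  the vertex sets of the facets of the face \<open>F\<close>.\<close>

definition coatoms_below :: "'b set set \<Rightarrow> 'b set \<Rightarrow> 'b set set" where
  "coatoms_below A F = inclusion_maximal {x \<in> A. x \<subset> F}"

lemma coatoms_belowD:
  assumes "x \<in> coatoms_below A F"
  shows "x \<in> A" "x \<subset> F" "\<And>y. y \<in> A \<Longrightarrow> y \<subset> F \<Longrightarrow> x \<subseteq> y \<Longrightarrow> y = x"
  using assms by (auto simp: coatoms_below_def inclusion_maximal_def)

definition not_ignored :: "'b set list \<Rightarrow> 'b set set" where
  "not_ignored I = {x. \<forall>y\<in>set I. \<not> x \<subseteq> y}"

lemma not_ignored_mono: "x \<in> not_ignored I \<Longrightarrow> x \<subseteq> y \<Longrightarrow> y \<in> not_ignored I"
  unfolding not_ignored_def by blast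

text \<open>\<open>separating_coatom\<close> abstracts the fact that a face is the intersection of
  the facets containing it: if \<open>x\<close> is strictly smaller than \<open>a\<close>, one of
  them must miss part of \<open>a\<close>. For \<open>a = F\<close> it says that \<open>x\<close>
  lies below some coatom of \<open>F\<close>.\<close>

locale coatomic_family =
  fixes A :: "nat set set"
  assumes inter_closed: "x \<in> A \<Longrightarrow> y \<in> A \<Longrightarrow> x \<inter> y \<in> A"
    and separating_coatom: "\<lbrakk>x \<in> A; x \<noteq> {}; a \<in> A; F \<in> A; x \<subset> a; a \<subseteq> F\<rbrakk>
      \<Longrightarrow> \<exists>b\<in>coatoms_below A F. x \<subseteq> b \<and> \<not> a \<subseteq> b"
begin

text \<open>An intersection \<open>a \<inter> b\<close> may be too small to be a coatom of
  \<open>a\<close>, but it then lies in a coatom of \<open>a\<close> that is also such an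
  intersection, so the maximality filter removes it. Hence the invariant on \<open>C\<close> passes
  from \<open>F\<close> to \<open>a\<close>.\<close>

lemma next_faces_eq:
  assumes "F \<in> A" "I \<noteq> []"
    and C: "set C = coatoms_below A F \<inter> not_ignored I"
    and a: "a \<in> set C"
  shows "next_faces C I a = coatoms_below A a \<inter> not_ignored I"
proof -
  define N2 where "N2 = {a \<inter> b | b. b \<in> set C \<and> b \<noteq> a} \<inter> not_ignored I"
  have N2: "next_faces C I a = inclusion_maximal N2"
    by (simp add: next_faces_def N2_def not_ignored_def Let_def Int_def)
  have aF: "a \<in> coatoms_below A F" using a C by simp
  have proper: "x \<in> A \<and> x \<subset> a \<and> x \<in> not_ignored I" if x: "x \<in> N2" for x
  proof -
    obtain b where b: "b \<in> coatoms_below A F" "b \<noteq> a" "x = a \<inter> b" "x \<in> not_ignored I"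
      using x unfolding N2_def C by blast
    \<comment> \<open>Distinct coatoms of \<open>F\<close> are incomparable, so
      \<open>a \<inter> b\<close> is strictly below \<open>a\<close>.\<close>
    have "\<not> a \<subseteq> b"
      using coatoms_belowD[OF aF] coatoms_belowD[OF b(1)] b(2) by metis
    then show ?thesis
      using b inter_closed coatoms_belowD(1)[OF aF] coatoms_belowD(1)[OF b(1)] by blast
  qed
  \<comment> \<open>The empty set is contained in every ignored set, and there is at least
    one.\<close>
  have nonempty: "x \<noteq> {}" if "x \<in> not_ignored I" for x
    using that \<open>I \<noteq> []\<close> by (cases I) (auto simp: not_ignored_def)
  have coatom_N2: "x \<in> N2" if x: "x \<in> coatoms_below A a" "x \<in> not_ignored I" for x
  proof -
    obtain b where b: "b \<in> coatoms_below A F" "x \<subseteq> b" "\<not> a \<subseteq> b"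
      using separating_coatom[of x a F] coatoms_belowD[OF aF] coatoms_belowD[OF x(1)]
        nonempty[OF x(2)] assms(1) by blast
    have "b \<in> set C"
      using b x(2) not_ignored_mono unfolding C by blast
    \<comment> \<open>\<open>a \<inter> b\<close> belongs to \<open>A\<close>, contains
      \<open>x\<close> and is strictly below \<open>a\<close>, so the coatom \<open>x\<close> cannot
      be smaller.\<close>
    moreover have "a \<inter> b = x"
      using coatoms_belowD[OF x(1)] b inter_closed coatoms_belowD(1)[OF aF]
        coatoms_belowD(1)[OF b(1)] by blast
    ultimately show ?thesis
      using b x(2) by (auto simp: N2_def)
  qed
  show ?thesis
  proof (intro equalityI subsetI)
    fix x assume "x \<in> next_faces C I a"
    then have x: "x \<in> N2" and max: "\<And>y. y \<in> N2 \<Longrightarrow> \<not> x \<subset> y"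
      by (auto simp: N2 inclusion_maximal_def)
    obtain g where g: "g \<in> coatoms_below A a" "x \<subseteq> g"
      using separating_coatom[of x a a] proper[OF x] nonempty[of x] coatoms_belowD(1)[OF aF] by auto
    have "g \<in> not_ignored I"
      using proper[OF x] g(2) not_ignored_mono by blast
    then have "g = x"
      using max coatom_N2 g by blast
    then show "x \<in> coatoms_below A a \<inter> not_ignored I"
      using g(1) proper[OF x] by simp
  next
    fix x assume x: "x \<in> coatoms_below A a \<inter> not_ignored I"
    then have "\<not> x \<subset> y" if "y \<in> N2" for y
      using proper[OF that] coatoms_belowD(3)[of x A a y] by blast
    then show "x \<in> next_faces C I a"
      using coatom_N2 x by (auto simp: N2 inclusion_maximal_def)
  qed
qed

text \<open>Strong induction on the length of \<open>C\<close> with \<open>F\<close> and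
  \<open>I\<close> varying: the first recursive call descends to \<open>a\<close> with the same
  \<open>I\<close>, the second stays at \<open>F\<close> and ignores everything inside
  \<open>a\<close>.\<close>

lemma face_iterator_output:
  assumes "F \<in> A" "I \<noteq> []"
    and "lists_set C (coatoms_below A F \<inter> not_ignored I)"
    and "out \<in> face_iterator C I {}"
  shows "distinct out \<and> set out = {x \<in> A. x \<subset> F} \<inter> not_ignored I"
  using assms
proof (induction "length C" arbitrary: C I F out rule: less_induct)
  case less
  have nonempty: "x \<noteq> {}" if "x \<in> not_ignored I" for x
    using that \<open>I \<noteq> []\<close> by (cases I) (auto simp: not_ignored_def)
  have C: "set C = coatoms_below A F \<inter> not_ignored I" "distinct C"
    using less.prems by (auto simp: lists_set_def)
  have below: "\<exists>c\<in>set C. x \<subseteq> c" if x: "x \<in> A" "x \<subset> F" "x \<in> not_ignored I" for x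
  proof -
    obtain c where c: "c \<in> coatoms_below A F" "x \<subseteq> c"
      using separating_coatom[of x F F] x nonempty[of x] less.prems(1) by auto
    then have "c \<in> not_ignored I"
      using x(3) not_ignored_mono by blast
    then show ?thesis
      using c C(1) by blast
  qed
  show ?case
  proof (cases C)
    case Nil
    \<comment> \<open>If every coatom of \<open>F\<close> is ignored, so is everything strictly
      below \<open>F\<close>, and the empty output is correct.\<close>
    then show ?thesis using less.prems(4) below by auto
  next
    case (Cons a D)
    obtain N C' out1 out2 where N: "lists_set N (next_faces C I a)"
      and C': "lists_set C' {x \<in> set C. \<not> x \<subseteq> a}"
      and out1: "out1 \<in> face_iterator N I {}"
      and out2: "out2 \<in> face_iterator C' (I @ [a]) {}"
      and out: "out = [a] @ out1 @ out2"
      using less.prems(4) unfolding Cons face_iterator.simps by auto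
    have a: "a \<in> set C" by (simp add: Cons)
    then have aF: "a \<in> coatoms_below A F" "a \<in> not_ignored I" using C by auto
    have "distinct out1 \<and> set out1 = {x \<in> A. x \<subset> a} \<inter> not_ignored I"
    proof (rule less.hyps)
      show "length N < length C"
        using next_faces_length[of N a D I] N Cons by simp
      show "lists_set N (coatoms_below A a \<inter> not_ignored I)"
        using N next_faces_eq[OF less.prems(1,2) C(1) a] by simp
    qed (use coatoms_belowD(1)[OF aF(1)] less.prems(2) out1 in auto)
    moreover have "distinct out2 \<and> set out2 = {x \<in> A. x \<subset> F} \<inter> not_ignored (I @ [a])"
    proof (rule less.hyps)
      show "length C' < length C"
        using remaining_length[of C' a D "{}"] C' Cons by simp
      \<comment> \<open>Since \<open>J\<close> is empty, the new ignored set is \<open>a\<close>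
        itself, so the deletion from \<open>C\<close> matches the extension of
        \<open>I\<close>.\<close>
      have "{x \<in> set C. \<not> x \<subseteq> a} = coatoms_below A F \<inter> not_ignored (I @ [a])"
        unfolding C(1) by (auto simp: not_ignored_def)
      then show "lists_set C' (coatoms_below A F \<inter> not_ignored (I @ [a]))"
        using C' by simp
    qed (use less.prems(1) out2 in auto)
    moreover have "not_ignored (I @ [a]) = not_ignored I - Pow a"
      by (auto simp: not_ignored_def)
    \<comment> \<open>The members to be visited split into \<open>a\<close>, those strictly inside
      \<open>a\<close>, and those not inside \<open>a\<close>. The three classes are disjoint, which
      gives \<open>distinct out\<close>.\<close>
    moreover have "{x \<in> A. x \<subset> F} \<inter> not_ignored I =
        insert a (({x \<in> A. x \<subset> a} \<inter> not_ignored I) \<union> ({x \<in> A. x \<subset> F} \<inter> (not_ignored I - Pow a)))"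
      using aF(2) coatoms_belowD(1,2)[OF aF(1)] by blast
    ultimately show ?thesis
      unfolding out by auto
  qed
qed

end

subsection \<open>Vertex sets of the faces of a polytope\<close>

text \<open>By Krein-Milman a face is the convex hull of its extreme points, and these are vertices
  of \<open>Q\<close>. So labels determine faces together with their order.\<close>

lemma vertex_labels_subset_iff:
  assumes Q: "polytope Q" and v: "bij_betw v {1..n} (vertices Q)"
    and H: "H face_of Q" and K: "K face_of Q"
  shows "vertex_labels v n H \<subseteq> vertex_labels v n K \<longleftrightarrow> H \<subseteq> K"
proof
  assume sub: "vertex_labels v n H \<subseteq> vertex_labels v n K"
  have pH: "polytope H"
    using Q H face_of_polytope_polytope by blast
  have "{x. x extreme_point_of H} \<subseteq> K"
  proof
    fix x assume "x \<in> {x. x extreme_point_of H}"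
    then have x: "x \<in> vertices Q" "x \<in> H"
      using extreme_point_of_face[OF H] by (auto simp: vertices_def)
    obtain i where i: "i \<in> {1..n}" "v i = x"
      using x(1) v unfolding bij_betw_def by (metis imageE)
    then have "i \<in> vertex_labels v n H"
      using x(2) by (simp add: vertex_labels_def)
    then show "x \<in> K"
      using sub i by (auto simp: vertex_labels_def)
  qed
  then have "convex hull {x. x extreme_point_of H} \<subseteq> K"
    using face_of_imp_convex[OF K] by (simp add: hull_minimal)
  then show "H \<subseteq> K"
    using Krein_Milman_Minkowski[of H] pH polytope_imp_compact polytope_imp_convex by blast
qed (auto simp: vertex_labels_def)

context
  fixes Q :: "'a::euclidean_space set" and v :: "nat \<Rightarrow> 'a" and n :: nat
  assumes Q: "polytope Q" and v: "bij_betw v {1..n} (vertices Q)"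
begin

lemma inj_on_vertex_labels: "inj_on (vertex_labels v n) {H. H face_of Q}"
  by (rule inj_onI) (use vertex_labels_subset_iff[OF Q v] in blast)

lemma vertex_labels_psubset_iff:
  assumes "H face_of Q" "K face_of Q"
  shows "vertex_labels v n H \<subset> vertex_labels v n K \<longleftrightarrow> H \<subset> K"
  using vertex_labels_subset_iff[OF Q v] assms by (simp add: less_le_not_le)

text \<open>Dimension increases strictly along proper inclusions of faces, which leaves no room
  between a facet and \<open>F\<close>.\<close>

lemma facet_label_coatom:
  assumes F: "F face_of Q" and H: "H facet_of F"
  shows "vertex_labels v n H \<in> coatoms_below (vertex_labels v n ` {H. H face_of Q}) (vertex_labels v n F)"
proof -
  have HQ: "H face_of Q"
    using face_of_trans[OF facet_of_imp_face_of[OF H] F] .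
  have "H \<subset> F"
    using H facet_of_imp_subset facet_of_irrefl by blast
  moreover have "\<not> H \<subset> K" if K: "K face_of Q" "K \<subset> F" for K
  proof
    assume HK: "H \<subset> K"
    have "K face_of F"
      by (rule face_of_subset[OF K(1)]) (use K(2) face_of_imp_subset[OF F] in auto)
    then have "aff_dim K < aff_dim F"
      using K(2) by (intro face_of_aff_dim_lt[OF face_of_imp_convex[OF F]]) auto
    moreover have "H face_of K"
      by (rule face_of_subset[OF HQ]) (use HK face_of_imp_subset[OF K(1)] in auto)
    then have "aff_dim H < aff_dim K"
      using HK by (intro face_of_aff_dim_lt[OF face_of_imp_convex[OF K(1)]]) auto
    ultimately show False
      using H by (simp add: facet_of_def)
  qed
  ultimately show ?thesis
    using HQ F by (auto simp: coatoms_below_def inclusion_maximal_def vertex_labels_psubset_iff)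
qed

lemma coatomic_family_vertex_labels:
  "coatomic_family (vertex_labels v n ` {H. H face_of Q})"
proof
  fix x y
  assume "x \<in> vertex_labels v n ` {H. H face_of Q}" "y \<in> vertex_labels v n ` {H. H face_of Q}"
  then obtain H K where HK: "H face_of Q" "K face_of Q" "x = vertex_labels v n H" "y = vertex_labels v n K"
    by blast
  have "x \<inter> y = vertex_labels v n (H \<inter> K)"
    by (auto simp: HK vertex_labels_def)
  then show "x \<inter> y \<in> vertex_labels v n ` {H. H face_of Q}"
    using face_of_Int[OF HK(1,2)] by blast
next
  fix x a f
  assume "x \<in> vertex_labels v n ` {H. H face_of Q}" "a \<in> vertex_labels v n ` {H. H face_of Q}"
    "f \<in> vertex_labels v n ` {H. H face_of Q}" and x: "x \<noteq> {}" "x \<subset> a" "a \<subseteq> f"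
  then obtain X K F where faces: "X face_of Q" "K face_of Q" "F face_of Q"
    and eq: "x = vertex_labels v n X" "a = vertex_labels v n K" "f = vertex_labels v n F"
    by blast
  have "X \<noteq> {}"
    using x(1) by (auto simp: eq vertex_labels_def)
  have XK: "X \<subset> K" "K \<subseteq> F"
    using x faces vertex_labels_psubset_iff vertex_labels_subset_iff[OF Q v] by (simp_all add: eq)
  have "X face_of F"
    using faces XK face_of_imp_subset[OF faces(3)] by (meson dual_order.trans face_of_subset psubset_imp_subset)
  moreover have "polyhedron F"
    using face_of_polytope_polytope[OF Q faces(3)] polytope_imp_polyhedron by blast
  \<comment> \<open>Since \<open>K\<close> is strictly larger than this intersection, one of the
    facets fails to contain \<open>K\<close>.\<close>
  ultimately have "X = \<Inter>{H. H facet_of F \<and> X \<subseteq> H}"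
    using face_of_polyhedron[of F X] \<open>X \<noteq> {}\<close> XK by blast
  then obtain H where H: "H facet_of F" "X \<subseteq> H" "\<not> K \<subseteq> H"
    using XK(1) by blast
  have HQ: "H face_of Q"
    using face_of_trans[OF facet_of_imp_face_of[OF H(1)] faces(3)] .
  show "\<exists>b\<in>coatoms_below (vertex_labels v n ` {H. H face_of Q}) f. x \<subseteq> b \<and> \<not> a \<subseteq> b"
    unfolding eq
  proof (rule bexI[OF _ facet_label_coatom[OF faces(3) H(1)]])
    show "vertex_labels v n X \<subseteq> vertex_labels v n H \<and>
        \<not> vertex_labels v n K \<subseteq> vertex_labels v n H"
      using vertex_labels_subset_iff[OF Q v] faces HQ H by blast
  qed
qed

text \<open>This puts the initial call into the form required by the induction. A face not contained
  in \<open>F\<close> is non-empty, so if it is proper it lies in a facet, and a coatom must equal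
  that facet.\<close>

lemma facet_labels_eq_coatoms:
  assumes F: "F face_of Q"
  shows "vertex_labels v n ` {H. H facet_of Q \<and> \<not> H \<subseteq> F}
    = coatoms_below (vertex_labels v n ` {H. H face_of Q}) (vertex_labels v n Q)
      \<inter> not_ignored [vertex_labels v n F]"
    (is "?l = ?r")
proof (intro equalityI subsetI)
  have QQ: "Q face_of Q"
    using Q polytope_imp_convex face_of_refl by blast
  {
    fix x assume "x \<in> ?l"
    then obtain H where "H facet_of Q" "\<not> H \<subseteq> F" "x = vertex_labels v n H" by blast
    then show "x \<in> ?r"
      using facet_label_coatom[OF QQ] vertex_labels_subset_iff[OF Q v _ F] facet_of_imp_face_of
      by (auto simp: not_ignored_def)
  next
    fix x assume x: "x \<in> ?r"
    note xD = coatoms_belowD[OF IntD1[OF x]]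
    obtain X where X: "X face_of Q" "x = vertex_labels v n X"
      using xD(1) by blast
    have XF: "\<not> X \<subseteq> F"
      using x X vertex_labels_subset_iff[OF Q v X(1) F] by (simp add: not_ignored_def)
    have "X \<noteq> Q" using xD(2) X by blast
    then obtain H where H: "H facet_of Q" "X \<subseteq> H"
      using face_of_polyhedron_subset_facet[OF polytope_imp_polyhedron[OF Q] X(1)] XF by blast
    have "vertex_labels v n H = x"
      using xD(3) facet_label_coatom[OF QQ H(1), THEN coatoms_belowD(1)]
        facet_label_coatom[OF QQ H(1), THEN coatoms_belowD(2)] H(2) X(2)
      by (auto simp: vertex_labels_def)
    then show "x \<in> ?l"
      using H XF by blast
  }
qed

end

subsection \<open>Faces under a projective transformation\<close>

lemma linear_homogenized_eq_affine:
  fixes f :: "'a::euclidean_space \<times> real \<Rightarrow> real"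
  assumes "linear f"
  obtains c d where "\<And>x. f (x, 1) = c \<bullet> x + d"
proof -
  have "linear (\<lambda>x. f (x, 0))"
  proof (rule linearI)
    fix x y :: 'a
    show "f (x + y, 0) = f (x, 0) + f (y, 0)"
      using linear_add[OF assms, of "(x, 0)" "(y, 0)"] by simp
  next
    fix r :: real and x :: 'a
    show "f (r *\<^sub>R x, 0) = r *\<^sub>R f (x, 0)"
      using linear_cmul[OF assms, of r "(x, 0)"] by simp
  qed
  \<comment> \<open>The adjoint at 1 is the vector representing the functional as an inner
    product.\<close>
  then have "f (x, 0) = adjoint (\<lambda>x. f (x, 0)) 1 \<bullet> x" for x
    by (simp add: adjoint_clauses)
  moreover have "f (x, 1) = f (x, 0) + f (0, 1)" for x
    using linear_add[OF assms, of "(x, 0)" "(0, 1)"] by simp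
  ultimately show ?thesis
    using that by metis
qed

lemma face_of_linear_nonpos:
  fixes f :: "'a::euclidean_space \<times> real \<Rightarrow> real"
  assumes f: "linear f" and S: "convex S" and le: "\<And>x. x \<in> S \<Longrightarrow> f (x, 1) \<le> 0"
  shows "{x \<in> S. f (x, 1) = 0} face_of S"
proof -
  obtain c d where cd: "\<And>x. f (x, 1) = c \<bullet> x + d"
    using linear_homogenized_eq_affine[OF f] by blast
  have "S \<inter> {x. c \<bullet> x = - d} face_of S"
    by (rule face_of_Int_supporting_hyperplane_le[OF S]) (use le cd in force)
  moreover have "{x \<in> S. f (x, 1) = 0} = S \<inter> {x. c \<bullet> x = - d}"
    by (auto simp: cd)
  ultimately show ?thesis by simp
qed

text \<open>Faces of polyhedra are exposed. Homogenizing the supporting inequality makes it a linear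
  functional, which can be composed with \<open>L\<close> or its inverse.\<close>

lemma face_of_polyhedron_linear:
  fixes S :: "'a::euclidean_space set"
  assumes "polyhedron S" "F face_of S"
  obtains f :: "'a \<times> real \<Rightarrow> real" where "linear f" "\<And>x. x \<in> S \<Longrightarrow> f (x, 1) \<le> 0"
    "F = {x \<in> S. f (x, 1) = 0}"
proof -
  obtain a b where ab: "S \<subseteq> {x. a \<bullet> x \<le> b}" "F = S \<inter> {x. a \<bullet> x = b}"
    using exposed_face_of_polyhedron[OF assms(1), of F] assms(2) by (auto simp: exposed_face_of_def)
  show ?thesis
  proof (rule that[of "\<lambda>z. a \<bullet> fst z - b * snd z"])
    show "linear (\<lambda>z. a \<bullet> fst z - b * snd z)"
      by (rule linearI) (simp_all add: inner_right_distrib algebra_simps)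
  qed (use ab in auto)
qed

text \<open>Each \<open>y\<close> in \<open>S\<close> is a limit of points on the open segment
  towards \<open>z\<close>, where \<open>f\<close> is positive. That segment is empty for
  \<open>y = z\<close>, hence the case split.\<close>

lemma closure_Int_pos_linear:
  fixes f :: "'a::euclidean_space \<times> real \<Rightarrow> real"
  assumes f: "linear f" and S: "closed S" "convex S"
    and ge: "\<And>y. y \<in> S \<Longrightarrow> 0 \<le> f (y, 1)" and z: "z \<in> S" "0 < f (z, 1)"
  shows "closure {y \<in> S. 0 < f (y, 1)} = S"
proof (intro equalityI subsetI)
  fix y assume "y \<in> closure {y \<in> S. 0 < f (y, 1)}"
  then show "y \<in> S"
    using closure_minimal[OF _ S(1), of "{y \<in> S. 0 < f (y, 1)}"] by auto
next
  fix y assume y: "y \<in> S"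
  show "y \<in> closure {y \<in> S. 0 < f (y, 1)}"
  proof (cases "y = z")
    case True
    have "z \<in> {y \<in> S. 0 < f (y, 1)}" using z by simp
    then show ?thesis unfolding True by (rule subsetD[OF closure_subset])
  next
    case False
    obtain c d where cd: "\<And>x. f (x, 1) = c \<bullet> x + d"
      using linear_homogenized_eq_affine[OF f] by blast
    have "open_segment y z \<subseteq> {y \<in> S. 0 < f (y, 1)}"
    proof
      fix x assume x: "x \<in> open_segment y z"
      then obtain u where u: "0 < u" "u < 1" "x = (1 - u) *\<^sub>R y + u *\<^sub>R z"
        by (auto simp: in_segment)
      have "x \<in> S"
        using x S(2) y z(1) by (meson convex_contains_open_segment subsetD)
      moreover have "f (x, 1) = (1 - u) * f (y, 1) + u * f (z, 1)"
        unfolding cd u(3) by (simp add: inner_right_distrib algebra_simps)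
      then have "0 < f (x, 1)"
        using u ge[OF y] z(2) by (simp add: add_nonneg_pos)
      ultimately show "x \<in> {y \<in> S. 0 < f (y, 1)}" by simp
    qed
    then have "closure (open_segment y z) \<subseteq> closure {y \<in> S. 0 < f (y, 1)}"
      by (rule closure_mono)
    then show ?thesis using False by auto
  qed
qed

section \<open>Inverse and sign of a projective transformation\<close>

lemma projective_map_inverse:
  assumes "linear M" and M_L: "\<And>z. M (L z) = z" and nz: "snd (L (x, 1)) \<noteq> 0"
  shows "M (projective_map L x, 1) = (x, 1) /\<^sub>R snd (L (x, 1))"
    and "snd (M (projective_map L x, 1)) = inverse (snd (L (x, 1)))"
    and "projective_map M (projective_map L x) = x"
proof -
  \<comment> \<open>Both sides represent the same projective point, so \<open>M\<close> returns a
    multiple of \<open>(x, 1)\<close>.\<close>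
  have "(projective_map L x, 1) = L (x, 1) /\<^sub>R snd (L (x, 1))"
    using nz by (simp add: projective_map_def prod_eq_iff)
  then show *: "M (projective_map L x, 1) = (x, 1) /\<^sub>R snd (L (x, 1))"
    using linear_cmul[OF assms(1)] M_L by simp
  show "snd (M (projective_map L x, 1)) = inverse (snd (L (x, 1)))"
    by (simp add: *)
  show "projective_map M (projective_map L x) = x"
    using nz by (simp add: projective_map_def[of M] *)
qed

text \<open>The denominator is affine and has no zero on the connected set \<open>P\<close>, so its
  sign is constant there. Passing from \<open>L\<close> to its negative flips the sign without
  changing the quotient.\<close>

lemma admissible_projective_positive:
  assumes adm: "admissible_projective L P" and P: "convex P"
  obtains L' where "linear L'" "bij L'" "\<And>x. x \<in> P \<Longrightarrow> 0 < snd (L' (x, 1))"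
    "projective_map L' = projective_map L"
proof -
  have L: "linear L" "bij L" and nz: "\<And>x. x \<in> P \<Longrightarrow> snd (L (x, 1)) \<noteq> 0"
    using adm by (auto simp: admissible_projective_def)
  have "linear (\<lambda>z. snd (L z))"
    using linear_compose[OF L(1) linear_snd] by (simp add: o_def)
  then obtain c d where cd: "\<And>x. snd (L (x, 1)) = c \<bullet> x + d"
    by (rule linear_homogenized_eq_affine[where f = "\<lambda>z. snd (L z)"]) blast
  consider "\<forall>x\<in>P. 0 < snd (L (x, 1))" | "\<forall>x\<in>P. snd (L (x, 1)) < 0"
  proof (rule ccontr)
    assume "\<not> thesis"
    with that obtain x y where xy: "x \<in> P" "y \<in> P" "c \<bullet> x \<le> - d" "- d \<le> c \<bullet> y"
      unfolding cd by (metis add.commute add_0 less_diff_eq diff_less_eq diff_0 not_less)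
    then obtain z where "z \<in> P" "c \<bullet> z = - d"
      using connected_ivt_hyperplane[OF convex_connected[OF P]] by blast
    then show False using nz[of z] cd by simp
  qed
  then show ?thesis
  proof cases
    case 1
    then show ?thesis using that L by blast
  next
    case 2
    show ?thesis
    proof (rule that[of "\<lambda>z. - L z"])
      show "linear (\<lambda>z. - L z)"
        using L(1) by (rule linear_compose_neg)
      show "bij (\<lambda>z. - L z)"
        using bij_comp[OF L(2) bij_uminus] by (simp add: o_def)
      show "projective_map (\<lambda>z. - L z) = projective_map L"
        by (auto simp: projective_map_def fun_eq_iff)
    qed (use 2 in auto)
  qed
qed

text \<open>\<open>M\<close> is the inverse of \<open>L\<close>. Positive denominators let
  inequalities on \<open>P\<close> keep their direction under the transformation.\<close>

locale positive_projective =
  fixes L M :: "'a::euclidean_space \<times> real \<Rightarrow> 'a \<times> real" and P :: "'a set"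
  assumes linear_L: "linear L" and linear_M: "linear M"
    and M_L: "M (L z) = z" and L_M: "L (M z) = z"
    and polyhedron_P: "polyhedron P"
    and pos: "x \<in> P \<Longrightarrow> 0 < snd (L (x, 1))"
begin

section \<open>The image and the points at infinity, separated by the inverse denominator\<close>

lemma linear_snd_M: "linear (\<lambda>z. snd (M z))"
  using linear_compose[OF linear_M linear_snd] by (simp add: o_def)

lemma snd_M_pos: "x \<in> P \<Longrightarrow> 0 < snd (M (projective_map L x, 1))"
  using projective_map_inverse(2)[OF linear_M M_L] pos by force

lemma projective_map_M_L: "x \<in> P \<Longrightarrow> projective_map M (projective_map L x) = x"
  using projective_map_inverse(3)[OF linear_M M_L] pos by force

lemma projective_map_L_M: "snd (M (y, 1)) \<noteq> 0 \<Longrightarrow> projective_map L (projective_map M y) = y"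
  using projective_map_inverse(3)[OF linear_L L_M] .

lemma continuous_homogenized: "linear f \<Longrightarrow> continuous_on S (\<lambda>x. f (x, 1))"
  for f :: "'a \<times> real \<Rightarrow> 'b::real_normed_vector"
  using linear_continuous_on_compose[of S "\<lambda>x. (x, 1)" f] by (simp add: continuous_intros)

lemma closure_le:
  fixes f :: "'a \<times> real \<Rightarrow> real"
  assumes f: "linear f" and le: "\<And>y. y \<in> projective_map L ` P \<Longrightarrow> f (y, 1) \<le> 0"
    and y: "y \<in> projective_closure L P"
  shows "f (y, 1) \<le> 0"
proof -
  have "closed {y. f (y, 1) \<le> 0}"
    using continuous_homogenized[OF f] by (intro closed_Collect_le) auto
  then have "projective_closure L P \<subseteq> {y. f (y, 1) \<le> 0}"
    unfolding projective_closure_def using le by (intro closure_minimal) auto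
  then show ?thesis using y by blast
qed

lemma snd_M_nonneg: "y \<in> projective_closure L P \<Longrightarrow> 0 \<le> snd (M (y, 1))"
  using closure_le[of "\<lambda>z. - snd (M z)" y] linear_compose_neg[OF linear_snd_M] snd_M_pos
  by (force simp: less_imp_le)

text \<open>The closure adds only points where the inverse denominator vanishes: elsewhere the
  inverse map is continuous, so it sends a limit of image points to a limit of points of
  \<open>P\<close>, and \<open>P\<close> is closed.\<close>

lemma image_eq: "projective_map L ` P = {y \<in> projective_closure L P. 0 < snd (M (y, 1))}"
proof (intro equalityI subsetI)
  fix y assume "y \<in> projective_map L ` P"
  then show "y \<in> {y \<in> projective_closure L P. 0 < snd (M (y, 1))}"
    using snd_M_pos closure_subset[of "projective_map L ` P"] by (auto simp: projective_closure_def)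
next
  fix y assume "y \<in> {y \<in> projective_closure L P. 0 < snd (M (y, 1))}"
  then have y: "y \<in> closure (projective_map L ` P)" "snd (M (y, 1)) \<noteq> 0"
    by (auto simp: projective_closure_def)
  obtain u where u: "\<And>k. u k \<in> projective_map L ` P" "u \<longlonglongrightarrow> y"
    using y(1) by (auto simp: closure_sequential)
  have "isCont (\<lambda>x. M (x, 1)) y"
    using continuous_homogenized[OF linear_M, of UNIV] by (simp add: continuous_on_eq_continuous_at)
  then have "isCont (projective_map M) y"
    unfolding projective_map_def[abs_def] using y(2) by (intro continuous_intros) auto
  then have "(\<lambda>k. projective_map M (u k)) \<longlonglongrightarrow> projective_map M y"
    using u(2) isCont_tendsto_compose by blast
  moreover have "projective_map M (u k) \<in> P" for k
    using u(1)[of k] projective_map_M_L by auto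
  ultimately have "projective_map M y \<in> P"
    by (rule closed_sequentially[OF polyhedron_imp_closed[OF polyhedron_P], rotated])
  then show "y \<in> projective_map L ` P"
    using projective_map_L_M[OF y(2)] by (metis imageI)
qed

lemma points_at_infinity_eq: "points_at_infinity L P = {y \<in> projective_closure L P. snd (M (y, 1)) = 0}"
  using snd_M_nonneg unfolding points_at_infinity_def image_eq by force

lemma subset_points_at_infinity_iff:
  "H \<subseteq> projective_closure L P \<Longrightarrow>
    H \<subseteq> points_at_infinity L P \<longleftrightarrow> \<not> (\<exists>z\<in>H. 0 < snd (M (z, 1)))"
  using snd_M_nonneg unfolding points_at_infinity_eq by force

lemma sign_transfer:
  fixes f :: "'a \<times> real \<Rightarrow> real"
  assumes f: "linear f" and x: "x \<in> P"
  shows "f (M (projective_map L x, 1)) = f (x, 1) / snd (L (x, 1))"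
proof -
  have "f (M (projective_map L x, 1)) = inverse (snd (L (x, 1))) * f (x, 1)"
    using projective_map_inverse(1)[OF linear_M M_L, of x] pos[OF x]
      linear_cmul[OF f, of "inverse (snd (L (x, 1)))" "(x, 1)"] by simp
  then show ?thesis by (simp add: divide_inverse mult.commute)
qed

section \<open>The correspondence between faces of the polyhedron and of the polytope\<close>

context
  assumes polytope_closure: "polytope (projective_closure L P)"
begin

lemma points_at_infinity_face: "points_at_infinity L P face_of projective_closure L P"
  using face_of_linear_nonpos[of "\<lambda>z. - snd (M z)" "projective_closure L P"]
    linear_compose_neg[OF linear_snd_M] polytope_imp_convex[OF polytope_closure] snd_M_nonneg
  by (simp add: points_at_infinity_eq)

lemma closure_part_at_finite:
  assumes "H face_of projective_closure L P" "\<not> H \<subseteq> points_at_infinity L P"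
  shows "closure {y \<in> H. 0 < snd (M (y, 1))} = H"
proof -
  have H: "H \<subseteq> projective_closure L P"
    using assms(1) by (rule face_of_imp_subset)
  obtain z where "z \<in> H" "0 < snd (M (z, 1))"
    using assms(2) subset_points_at_infinity_iff[OF H] by blast
  moreover have "polytope H"
    using assms(1) face_of_polytope_polytope polytope_closure by blast
  ultimately show ?thesis
    using closure_Int_pos_linear[OF linear_snd_M, of H z] snd_M_nonneg H
      polytope_imp_closed polytope_imp_convex by blast
qed

text \<open>The last conclusion recovers the image of \<open>G\<close> from its closure, which later
  yields injectivity.\<close>

lemma face_closure:
  assumes G: "G face_of P" "G \<noteq> {}"
  shows "projective_closure L G face_of projective_closure L P"
    and "\<not> projective_closure L G \<subseteq> points_at_infinity L P"
    and "{y \<in> projective_closure L G. 0 < snd (M (y, 1))} = projective_map L ` G"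
proof -
  obtain f :: "'a \<times> real \<Rightarrow> real" where f: "linear f" "\<And>x. x \<in> P \<Longrightarrow> f (x, 1) \<le> 0"
    "G = {x \<in> P. f (x, 1) = 0}"
    using face_of_polyhedron_linear[OF polyhedron_P G(1)] by blast
  \<comment> \<open>\<open>H\<close> is cut out by the inequality of \<open>G\<close> transported
    along \<open>M\<close>. It is a face by construction, and its part outside infinity is the image
    of \<open>G\<close>.\<close>
  define H where "H = {y \<in> projective_closure L P. f (M (y, 1)) = 0}"
  have fM: "linear (\<lambda>z. f (M z))"
    using linear_compose[OF linear_M f(1)] by (simp add: o_def)
  have "f (M (y, 1)) \<le> 0" if "y \<in> projective_map L ` P" for y
  proof -
    obtain x where x: "x \<in> P" "y = projective_map L x"
      using \<open>y \<in> projective_map L ` P\<close> by blast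
    show ?thesis
      unfolding x(2) sign_transfer[OF f(1) x(1)]
      by (rule divide_nonpos_pos[OF f(2)[OF x(1)] pos[OF x(1)]])
  qed
  then have "f (M (y, 1)) \<le> 0" if "y \<in> projective_closure L P" for y
    using closure_le[OF fM] that by blast
  then have H: "H face_of projective_closure L P"
    unfolding H_def using face_of_linear_nonpos[OF fM] polytope_imp_convex[OF polytope_closure] by blast
  have eq: "{y \<in> H. 0 < snd (M (y, 1))} = projective_map L ` G"
  proof -
    have "{y \<in> H. 0 < snd (M (y, 1))} = {y \<in> projective_map L ` P. f (M (y, 1)) = 0}"
      by (auto simp: H_def image_eq)
    also have "\<dots> = projective_map L ` G"
    proof (intro equalityI subsetI)
      fix y assume "y \<in> {y \<in> projective_map L ` P. f (M (y, 1)) = 0}"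
      then show "y \<in> projective_map L ` G"
        using sign_transfer[OF f(1)] pos by (force simp: f(3))
    qed (use sign_transfer[OF f(1)] in \<open>auto simp: f(3)\<close>)
    finally show ?thesis .
  qed
  have nH: "\<not> H \<subseteq> points_at_infinity L P"
    using subset_points_at_infinity_iff[OF face_of_imp_subset[OF H]] eq G(2) by blast
  have cl: "projective_closure L G = H"
    using closure_part_at_finite[OF H nH] by (simp add: projective_closure_def eq)
  show "projective_closure L G face_of projective_closure L P"
    and "\<not> projective_closure L G \<subseteq> points_at_infinity L P"
    and "{y \<in> projective_closure L G. 0 < snd (M (y, 1))} = projective_map L ` G"
    using H nH eq by (simp_all add: cl)
qed

lemma face_preimage:
  assumes H: "H face_of projective_closure L P" and nH: "\<not> H \<subseteq> points_at_infinity L P"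
  obtains G where "G face_of P" "G \<noteq> {}" "projective_closure L G = H"
proof -
  obtain f :: "'a \<times> real \<Rightarrow> real" where f: "linear f"
    "\<And>y. y \<in> projective_closure L P \<Longrightarrow> f (y, 1) \<le> 0"
    "H = {y \<in> projective_closure L P. f (y, 1) = 0}"
    using face_of_polyhedron_linear[OF polytope_imp_polyhedron[OF polytope_closure] H] by blast
  \<comment> \<open>Conversely, the inequality of \<open>H\<close> is pulled back along
    \<open>L\<close>.\<close>
  define G where "G = {x \<in> P. f (L (x, 1)) = 0}"
  have fL: "linear (\<lambda>z. f (L z))"
    using linear_compose[OF linear_L f(1)] by (simp add: o_def)
  have transfer: "f (L (x, 1)) = snd (L (x, 1)) * f (projective_map L x, 1)" if "x \<in> P" for x
  proof -
    have "L (x, 1) = snd (L (x, 1)) *\<^sub>R (projective_map L x, 1)"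
      using pos[OF that] by (simp add: projective_map_def prod_eq_iff)
    then show ?thesis
      using linear_cmul[OF f(1)] by (metis real_scaleR_def)
  qed
  have "f (L (x, 1)) \<le> 0" if "x \<in> P" for x
  proof -
    have "projective_map L x \<in> projective_closure L P"
      using that image_eq by blast
    then show ?thesis
      using transfer[OF that] f(2) pos[OF that] by (simp add: mult_le_0_iff)
  qed
  then have G: "G face_of P"
    unfolding G_def using face_of_linear_nonpos[OF fL] polyhedron_imp_convex[OF polyhedron_P] by blast
  have "{y \<in> H. 0 < snd (M (y, 1))} = {y \<in> projective_map L ` P. f (y, 1) = 0}"
    by (auto simp: f(3) image_eq)
  also have "\<dots> = projective_map L ` G"
    using transfer pos by (force simp: G_def)
  finally have eq: "{y \<in> H. 0 < snd (M (y, 1))} = projective_map L ` G" .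
  have "projective_closure L G = H"
    using closure_part_at_finite[OF H nH] by (simp add: projective_closure_def eq)
  moreover have "G \<noteq> {}"
    using eq nH subset_points_at_infinity_iff[OF face_of_imp_subset[OF H]] by blast
  ultimately show ?thesis using that G by blast
qed

lemma bij_betw_faces:
  "bij_betw (projective_closure L) {G. G face_of P \<and> G \<noteq> {}}
    {H. H face_of projective_closure L P \<and> \<not> H \<subseteq> points_at_infinity L P}"
  unfolding bij_betw_def
proof
  show "inj_on (projective_closure L) {G. G face_of P \<and> G \<noteq> {}}"
  proof (rule inj_onI)
    fix G G' assume *: "G \<in> {G. G face_of P \<and> G \<noteq> {}}" "G' \<in> {G. G face_of P \<and> G \<noteq> {}}"
      and eq: "projective_closure L G = projective_closure L G'"
    have "projective_map L ` G = projective_map L ` G'"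
      using face_closure(3)[of G] face_closure(3)[of G'] * eq by simp
    moreover have "inj_on (projective_map L) P"
      by (rule inj_on_inverseI) (rule projective_map_M_L)
    ultimately show "G = G'"
      using * by (simp add: inj_on_image_eq_iff face_of_imp_subset)
  qed
  show "projective_closure L ` {G. G face_of P \<and> G \<noteq> {}}
    = {H. H face_of projective_closure L P \<and> \<not> H \<subseteq> points_at_infinity L P}"
    (is "?l = ?r")
  proof (intro equalityI subsetI)
    fix H assume "H \<in> ?r"
    then obtain G where "G face_of P" "G \<noteq> {}" "projective_closure L G = H"
      using face_preimage by auto
    then show "H \<in> ?l" by auto
  qed (use face_closure(1,2) in auto)
qed

end

end

text \<open>The sign normalization leaves the projective map unchanged, hence also the closure and
  the points at infinity, so the results for positive denominators carry over.\<close>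

lemma bij_betw_projective_faces:
  assumes "polyhedron P" "admissible_projective L P" "polytope (projective_closure L P)"
  shows "points_at_infinity L P face_of projective_closure L P"
    and "bij_betw (projective_closure L) {G. G face_of P \<and> G \<noteq> {}}
      {H. H face_of projective_closure L P \<and> \<not> H \<subseteq> points_at_infinity L P}"
proof -
  obtain L' where L': "linear L'" "bij L'" "\<And>x. x \<in> P \<Longrightarrow> 0 < snd (L' (x, 1))"
    "projective_map L' = projective_map L"
    using admissible_projective_positive[OF assms(2) polyhedron_imp_convex[OF assms(1)]] by blast
  have cl: "projective_closure L' = projective_closure L"
    using L'(4) by (simp add: projective_closure_def fun_eq_iff)
  have inf: "points_at_infinity L' = points_at_infinity L"
    using L'(4) cl by (simp add: points_at_infinity_def fun_eq_iff)
  have "linear (inv L')"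
    using L'(1,2) by (simp add: bij_def inj_linear_imp_inv_linear)
  then interpret positive_projective L' "inv L'" P
    using L' assms(1)
    by (intro positive_projective.intro) (simp_all add: bij_is_inj bij_is_surj surj_f_inv_f)
  show "points_at_infinity L P face_of projective_closure L P"
    and "bij_betw (projective_closure L) {G. G face_of P \<and> G \<noteq> {}}
      {H. H face_of projective_closure L P \<and> \<not> H \<subseteq> points_at_infinity L P}"
    using points_at_infinity_face bij_betw_faces assms(3) by (simp_all add: cl inf)
qed

section \<open>The outputs of the algorithm as faces of the polyhedron\<close>

theorem corollary3p9:
  fixes P Pbar Fbar :: "'a::euclidean_space set"
    and L :: "'a \<times> real \<Rightarrow> 'a \<times> real"
    and v :: "nat \<Rightarrow> 'a" and n :: nat
    and C :: "nat set list"
  assumes "polyhedron P" and "\<not> bounded P"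
    and no_line: "\<not> (\<exists>x y. x \<noteq> y \<and> affine hull {x, y} \<subseteq> P)"
    and "admissible_projective L P"
    and "Pbar = projective_closure L P" and "polytope Pbar"
    and "Fbar = points_at_infinity L P"
    and labelling: "bij_betw v {1..n} (vertices Pbar)"
    and facets: "lists_set C (vertex_labels v n ` {H. H facet_of Pbar \<and> \<not> H \<subseteq> Fbar})"
  shows "face_iterator C [vertex_labels v n Fbar] {} \<noteq> {} \<and>
    (\<forall>out \<in> face_iterator C [vertex_labels v n Fbar] {}.
       distinct out \<and>
       bij_betw (\<lambda>G. vertex_labels v n (projective_closure L G))
         {G. G face_of P \<and> G \<noteq> {} \<and> G \<noteq> P} (set out) \<and>
       distinct (vertex_labels v n Pbar # out) \<and>
       bij_betw (\<lambda>G. vertex_labels v n (projective_closure L G))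
         {G. G face_of P \<and> G \<noteq> {}} (set (vertex_labels v n Pbar # out)))"
proof (intro conjI ballI)
  show "face_iterator C [vertex_labels v n Fbar] {} \<noteq> {}"
    by (rule face_iterator_nonempty)
  fix out assume out: "out \<in> face_iterator C [vertex_labels v n Fbar] {}"
  let ?l = "vertex_labels v n"
  let ?A = "?l ` {H. H face_of Pbar}"
  note Q = \<open>polytope Pbar\<close> labelling
  have F: "Fbar face_of Pbar"
    and bij: "bij_betw (projective_closure L) {G. G face_of P \<and> G \<noteq> {}}
      {H. H face_of Pbar \<and> \<not> H \<subseteq> Fbar}"
    using bij_betw_projective_faces[of P L] assms(1,4-7) by simp_all
  have PP: "P face_of P" and QQ: "Pbar face_of Pbar"
    using polyhedron_imp_convex[OF assms(1)] polytope_imp_convex[OF assms(6)]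
    by (simp_all add: face_of_refl)
  \<comment> \<open>An unbounded set is non-empty, so \<open>P\<close> is itself one of the faces
    counted, with closure \<open>Pbar\<close>.\<close>
  have "P \<noteq> {}"
    using assms(2) by auto
  interpret coatomic_family ?A
    by (rule coatomic_family_vertex_labels[OF Q])
  have visited: "distinct out \<and> set out = {x \<in> ?A. x \<subset> ?l Pbar} \<inter> not_ignored [?l Fbar]"
    by (rule face_iterator_output[OF _ _ _ out])
      (use facets facet_labels_eq_coatoms[OF Q F] QQ in simp_all)
  then have set_out: "set out = {x \<in> ?A. x \<subset> ?l Pbar} \<inter> not_ignored [?l Fbar]" ..
  show "distinct out" using visited ..
  then show "distinct (?l Pbar # out)" by (simp add: set_out)
  let ?B = "{H. H face_of Pbar \<and> \<not> H \<subseteq> Fbar}"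
  have PbarB: "Pbar \<in> ?B"
    using bij PP \<open>P \<noteq> {}\<close> assms(5) by (auto simp: bij_betw_def)
  \<comment> \<open>Back from labels to faces: strict inclusion in \<open>?l Pbar\<close> becomes
    \<open>H \<noteq> Pbar\<close>, and not being ignored becomes not lying in
    \<open>Fbar\<close>.\<close>
  have set_out': "set out = ?l ` (?B - {Pbar})"
  proof (intro equalityI subsetI)
    fix x assume "x \<in> set out"
    then obtain H where H: "H face_of Pbar" "x = ?l H" "?l H \<subset> ?l Pbar" "\<not> ?l H \<subseteq> ?l Fbar"
      by (auto simp: set_out not_ignored_def)
    then have "H \<in> ?B - {Pbar}"
      using vertex_labels_subset_iff[OF Q H(1) F] by auto
    then show "x \<in> ?l ` (?B - {Pbar})"
      using H(2) by simp
  next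
    fix x assume "x \<in> ?l ` (?B - {Pbar})"
    then obtain H where H: "H face_of Pbar" "x = ?l H" "\<not> H \<subseteq> Fbar" "H \<noteq> Pbar"
      by blast
    then have "?l H \<subset> ?l Pbar"
      using vertex_labels_psubset_iff[OF Q H(1) QQ] face_of_imp_subset[OF H(1)] by blast
    then show "x \<in> set out"
      using H vertex_labels_subset_iff[OF Q H(1) F] by (auto simp: set_out not_ignored_def)
  qed
  have "inj_on ?l ?B"
    by (rule inj_on_subset[OF inj_on_vertex_labels[OF Q]]) blast
  then have bij_l: "bij_betw ?l ?B (?l ` ?B)"
    by (rule inj_on_imp_bij_betw)
  have all: "bij_betw (\<lambda>G. ?l (projective_closure L G)) {G. G face_of P \<and> G \<noteq> {}} (?l ` ?B)"
    using bij_betw_trans[OF bij bij_l] by (simp add: o_def)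
  have "?l ` ?B = set (?l Pbar # out)"
    using PbarB by (auto simp: set_out')
  with all show all': "bij_betw (\<lambda>G. ?l (projective_closure L G))
      {G. G face_of P \<and> G \<noteq> {}} (set (?l Pbar # out))"
    by simp
  \<comment> \<open>Removing the upper bound from both sides, \<open>P\<close> from the faces and
    \<open>?l Pbar\<close> from the labels, leaves exactly what the algorithm outputs.\<close>
  have "{G. G face_of P \<and> G \<noteq> {} \<and> G \<noteq> P} = {G. G face_of P \<and> G \<noteq> {}} - {P}"
    by auto
  moreover have "set out = set (?l Pbar # out) - {?l Pbar}"
    by (auto simp: set_out)
  ultimately show "bij_betw (\<lambda>G. ?l (projective_closure L G))
      {G. G face_of P \<and> G \<noteq> {} \<and> G \<noteq> P} (set out)"
    using bij_betw_DiffI[OF all', of "{P}" "{?l Pbar}"] PP \<open>P \<noteq> {}\<close> assms(5)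
    by simp
qed

end
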